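(* Let $\Phi:P\to X$ and $\Psi:Q\to X$ be two functors between small categories with the same codomain, whose reflections in discrete fibrations over $X$ are isomorphic: ${\downarrow}\Phi\cong{\downarrow}\Psi$. Then for any functor $f:X\to Y$ $$\mathrm{Colim}(f\circ\Phi)\cong\mathrm{Colim}(f\circ\Psi),$$ either side existing if the other one does. Furthermore, $f\circ\Phi:P\to Y$ and $f\circ\Psi:Q\to Y$ have the same weak colimits.
   Context: $\mathbf{Cat}/X$ is the slice category: objects are functors $P\to X$ with $P$ small, morphisms are functors commuting with the projections to $X$. A discrete fibration over $X$ is a functor $\pi:A\to X$ such that for every object $a$ of $A$ and arrow $f:y\to\pi a$ of $X$ there is a unique arrow of $A$ with codomain $a$ over $f$. ${\downarrow}(-)$ is the left adjoint of the full inclusion of discrete fibrations over $X$ in $\mathbf{Cat}/X$; ${\downarrow}\Phi$ is the reflection of $\Phi$ regarded as an object of $\mathbf{Cat}/X$. A weak colimit of a functor is an object with a cone to it from the functor through which every other such cone factors, not necessarily uniquely. *)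

theory Defs
  imports Main
begin

section \<open>Categories and functors\<close>

text \<open>Objects and arrows are given by carrier sets; the operations are only meaningful on
  the carriers.  \<open>Comp C g f\<close> is the composite ``\<open>g\<close> after \<open>f\<close>''.\<close>

record ('o, 'a) cat =
  Obj :: "'o set"
  Arr :: "'a set"
  Dom :: "'a \<Rightarrow> 'o"
  Cod :: "'a \<Rightarrow> 'o"
  Id :: "'o \<Rightarrow> 'a"
  Comp :: "'a \<Rightarrow> 'a \<Rightarrow> 'a"

definition hom :: "('o, 'a) cat \<Rightarrow> 'o \<Rightarrow> 'o \<Rightarrow> 'a set" where
  "hom C x y = {f \<in> Arr C. Dom C f = x \<and> Cod C f = y}"

locale category =
  fixes C :: "('o, 'a) cat"
  assumes dom_in: "f \<in> Arr C \<Longrightarrow> Dom C f \<in> Obj C"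
    and cod_in: "f \<in> Arr C \<Longrightarrow> Cod C f \<in> Obj C"
    and id_in: "x \<in> Obj C \<Longrightarrow> Id C x \<in> hom C x x"
    and comp_in: "\<lbrakk>f \<in> hom C x y; g \<in> hom C y z\<rbrakk> \<Longrightarrow> Comp C g f \<in> hom C x z"
    and id_left: "f \<in> hom C x y \<Longrightarrow> Comp C (Id C y) f = f"
    and id_right: "f \<in> hom C x y \<Longrightarrow> Comp C f (Id C x) = f"
    and assoc: "\<lbrakk>f \<in> hom C w x; g \<in> hom C x y; h \<in> hom C y z\<rbrakk>
      \<Longrightarrow> Comp C h (Comp C g f) = Comp C (Comp C h g) f"

definition iso_obj :: "('o, 'a) cat \<Rightarrow> 'o \<Rightarrow> 'o \<Rightarrow> bool" where
  "iso_obj C x y \<longleftrightarrow> x \<in> Obj C \<and> y \<in> Obj C \<and>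
     (\<exists>f\<in>hom C x y. \<exists>g\<in>hom C y x. Comp C g f = Id C x \<and> Comp C f g = Id C y)"

record ('o, 'a, 'p, 'b) fctr =
  omap :: "'o \<Rightarrow> 'p"
  amap :: "'a \<Rightarrow> 'b"

locale is_functor = source: category C + target: category D
  for C :: "('o, 'a) cat" and D :: "('p, 'b) cat" +
  fixes F :: "('o, 'a, 'p, 'b) fctr"
  assumes omap_in: "x \<in> Obj C \<Longrightarrow> omap F x \<in> Obj D"
    and amap_in: "f \<in> hom C x y \<Longrightarrow> amap F f \<in> hom D (omap F x) (omap F y)"
    and amap_id: "x \<in> Obj C \<Longrightarrow> amap F (Id C x) = Id D (omap F x)"
    and amap_comp: "\<lbrakk>f \<in> hom C x y; g \<in> hom C y z\<rbrakk>
      \<Longrightarrow> amap F (Comp C g f) = Comp D (amap F g) (amap F f)"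

definition fid :: "('o, 'a, 'o, 'a) fctr" where
  "fid = \<lparr>omap = (\<lambda>x. x), amap = (\<lambda>f. f)\<rparr>"

definition fcomp ::
    "('p, 'b, 'q, 'c) fctr \<Rightarrow> ('o, 'a, 'p, 'b) fctr \<Rightarrow> ('o, 'a, 'q, 'c) fctr"
    (infixl "\<circ>\<^sub>F" 55) where
  "G \<circ>\<^sub>F F = \<lparr>omap = omap G \<circ> omap F, amap = amap G \<circ> amap F\<rparr>"

text \<open>Equality of functors with source \<open>C\<close>: the underlying total functions may differ
  outside the carriers.\<close>

definition functor_eq ::
    "('o, 'a) cat \<Rightarrow> ('o, 'a, 'p, 'b) fctr \<Rightarrow> ('o, 'a, 'p, 'b) fctr \<Rightarrow> bool" where
  "functor_eq C F G \<longleftrightarrow>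
     (\<forall>x\<in>Obj C. omap F x = omap G x) \<and> (\<forall>f\<in>Arr C. amap F f = amap G f)"

section \<open>The slice over \<open>X\<close> and the reflection in discrete fibrations\<close>

text \<open>An object of the slice over \<open>X\<close> is a category \<open>P\<close> with a functor
  \<open>\<Phi> : P \<rightarrow> X\<close>.\<close>

definition slice_mor ::
    "('x, 'y) cat \<Rightarrow> ('o, 'a) cat \<Rightarrow> ('o, 'a, 'x, 'y) fctr
      \<Rightarrow> ('p, 'b) cat \<Rightarrow> ('p, 'b, 'x, 'y) fctr \<Rightarrow> ('o, 'a, 'p, 'b) fctr \<Rightarrow> bool" where
  "slice_mor X P \<Phi> Q \<Psi> F \<longleftrightarrow>
     is_functor P X \<Phi> \<and> is_functor Q X \<Psi> \<and> is_functor P Q F \<and> functor_eq P (\<Psi> \<circ>\<^sub>F F) \<Phi>"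

definition slice_iso ::
    "('x, 'y) cat \<Rightarrow> ('o, 'a) cat \<Rightarrow> ('o, 'a, 'x, 'y) fctr
      \<Rightarrow> ('p, 'b) cat \<Rightarrow> ('p, 'b, 'x, 'y) fctr \<Rightarrow> bool" where
  "slice_iso X P \<Phi> Q \<Psi> \<longleftrightarrow>
     (\<exists>F G. slice_mor X P \<Phi> Q \<Psi> F \<and> slice_mor X Q \<Psi> P \<Phi> G \<and>
        functor_eq P (G \<circ>\<^sub>F F) fid \<and> functor_eq Q (F \<circ>\<^sub>F G) fid)"

definition discrete_fibration ::
    "('x, 'y) cat \<Rightarrow> ('o, 'a) cat \<Rightarrow> ('o, 'a, 'x, 'y) fctr \<Rightarrow> bool" where
  "discrete_fibration X A \<pi> \<longleftrightarrow> is_functor A X \<pi> \<and>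
     (\<forall>a\<in>Obj A. \<forall>f\<in>Arr X. Cod X f = omap \<pi> a \<longrightarrow>
        (\<exists>!g. g \<in> Arr A \<and> Cod A g = a \<and> amap \<pi> g = f))"

text \<open>\<open>(A, \<pi>)\<close> with unit \<open>\<eta>\<close> is a reflection of \<open>(P, \<Phi>)\<close> in discrete fibrations over
  \<open>X\<close>, that is, a value at \<open>(P, \<Phi>)\<close> of the left adjoint of the inclusion.  HOL cannot
  quantify over types inside a formula, so a type \<open>'u\<close> plays the role of the universe:
  the small categories are those whose objects and arrows are elements of \<open>'u\<close>.
  As soon as \<open>'u\<close> is infinite, every \<open>\<Phi>\<close> has a reflection in this sense: its fibre over \<open>x\<close>
  is the set of connected components of \<open>x/\<Phi>\<close>, so there are at most as many objects
  as pairs (arrow of \<open>X\<close>, object of \<open>P\<close>), and at most as many arrows as pairs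
  (arrow of \<open>X\<close>, object of the reflection).\<close>

definition df_reflection ::
    "('u, 'u) cat \<Rightarrow> ('u, 'u) cat \<Rightarrow> ('u, 'u, 'u, 'u) fctr
      \<Rightarrow> ('u, 'u) cat \<Rightarrow> ('u, 'u, 'u, 'u) fctr \<Rightarrow> ('u, 'u, 'u, 'u) fctr \<Rightarrow> bool" where
  "df_reflection X P \<Phi> A \<pi> \<eta> \<longleftrightarrow>
     discrete_fibration X A \<pi> \<and> slice_mor X P \<Phi> A \<pi> \<eta> \<and>
     (\<forall>(B :: ('u, 'u) cat) \<rho> F. discrete_fibration X B \<rho> \<and> slice_mor X P \<Phi> B \<rho> F \<longrightarrow>
        (\<exists>G. slice_mor X A \<pi> B \<rho> G \<and> functor_eq P (G \<circ>\<^sub>F \<eta>) F \<and>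
           (\<forall>G'. slice_mor X A \<pi> B \<rho> G' \<and> functor_eq P (G' \<circ>\<^sub>F \<eta>) F
              \<longrightarrow> functor_eq A G' G)))"

section \<open>Colimits and weak colimits\<close>

definition cocone ::
    "('o, 'a) cat \<Rightarrow> ('p, 'b) cat \<Rightarrow> ('o, 'a, 'p, 'b) fctr \<Rightarrow> 'p \<Rightarrow> ('o \<Rightarrow> 'b) \<Rightarrow> bool" where
  "cocone P Y F c \<kappa> \<longleftrightarrow> c \<in> Obj Y \<and>
     (\<forall>p\<in>Obj P. \<kappa> p \<in> hom Y (omap F p) c) \<and>
     (\<forall>u\<in>Arr P. Comp Y (\<kappa> (Cod P u)) (amap F u) = \<kappa> (Dom P u))"

definition is_colimit ::
    "('o, 'a) cat \<Rightarrow> ('p, 'b) cat \<Rightarrow> ('o, 'a, 'p, 'b) fctr \<Rightarrow> 'p \<Rightarrow> bool" where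
  "is_colimit P Y F c \<longleftrightarrow> (\<exists>\<kappa>. cocone P Y F c \<kappa> \<and>
     (\<forall>d \<mu>. cocone P Y F d \<mu> \<longrightarrow>
        (\<exists>!h. h \<in> hom Y c d \<and> (\<forall>p\<in>Obj P. Comp Y h (\<kappa> p) = \<mu> p))))"

definition is_weak_colimit ::
    "('o, 'a) cat \<Rightarrow> ('p, 'b) cat \<Rightarrow> ('o, 'a, 'p, 'b) fctr \<Rightarrow> 'p \<Rightarrow> bool" where
  "is_weak_colimit P Y F c \<longleftrightarrow> (\<exists>\<kappa>. cocone P Y F c \<kappa> \<and>
     (\<forall>d \<mu>. cocone P Y F d \<mu> \<longrightarrow>
        (\<exists>h. h \<in> hom Y c d \<and> (\<forall>p\<in>Obj P. Comp Y h (\<kappa> p) = \<mu> p))))"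

end

theory Submission
  imports Defs
begin

text \<open>A cocone from \<open>f \<circ> \<Phi>\<close> to \<open>c\<close> is a family of elements of the presheaf
  \<open>x \<mapsto> hom (f x) c\<close> on \<open>X\<close>, indexed by \<open>P\<close> and compatible with the action, that is, a
  morphism from \<open>\<Phi>\<close> to the discrete fibration \<open>f/c\<close>.  It therefore extends uniquely along the
  reflection unit, so \<open>f \<circ> \<Phi>\<close> and \<open>f \<circ> \<pi>\<close> have the same cocones, naturally in \<open>c\<close>,
  hence the same (weak) colimits.  As \<open>f/c\<close> need not be small, it is replaced
  by a sub-fibration whose objects inject into \<open>'u\<close>: the one generated by the family for the
  existence of the extension, the union of the images of two extensions for its uniqueness.\<close>

section \<open>Presheaves and their categories of elements\<close>

text \<open>A presheaf presented by its total set: \<open>pr\<close> tells over which object an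
  element lies, and \<open>act e u\<close> is the restriction of \<open>e\<close> along
  \<open>u\<close>. With all elements in one set \<open>E\<close>, smallness becomes the existence
  of an injection of \<open>E\<close> into \<open>'u\<close>.\<close>

locale presheaf = category X
  for X :: "('x, 'y) cat" +
  fixes E :: "'e set" and pr :: "'e \<Rightarrow> 'x" and act :: "'e \<Rightarrow> 'y \<Rightarrow> 'e"
  assumes pr_in: "e \<in> E \<Longrightarrow> pr e \<in> Obj X"
    and act_in: "\<lbrakk>e \<in> E; u \<in> hom X x (pr e)\<rbrakk> \<Longrightarrow> act e u \<in> E"
    and pr_act: "\<lbrakk>e \<in> E; u \<in> hom X x (pr e)\<rbrakk> \<Longrightarrow> pr (act e u) = x"
    and act_id: "e \<in> E \<Longrightarrow> act e (Id X (pr e)) = e"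
    and act_comp: "\<lbrakk>e \<in> E; u \<in> hom X y (pr e); v \<in> hom X x y\<rbrakk>
      \<Longrightarrow> act e (Comp X u v) = act (act e u) v"

text \<open>This is the object part of a morphism over \<open>X\<close> from \<open>\<Phi>\<close>
  to the category of elements; unique lifting forces the arrow part.\<close>

definition family ::
    "('o, 'a) cat \<Rightarrow> ('o, 'a, 'x, 'y) fctr
      \<Rightarrow> 'e set \<Rightarrow> ('e \<Rightarrow> 'x) \<Rightarrow> ('e \<Rightarrow> 'y \<Rightarrow> 'e) \<Rightarrow> ('o \<Rightarrow> 'e) \<Rightarrow> bool" where
  "family P \<Phi> E pr act h \<longleftrightarrow>
     (\<forall>p\<in>Obj P. h p \<in> E \<and> pr (h p) = omap \<Phi> p) \<and>
     (\<forall>u\<in>Arr P. h (Dom P u) = act (h (Cod P u)) (amap \<Phi> u))"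

text \<open>The category of elements; its arrows, which are pairs, are encoded by \<open>j\<close> so that
  they can be taken in the universe \<open>'u\<close>.\<close>

definition elements ::
    "('e \<times> 'y \<Rightarrow> 'v) \<Rightarrow> ('x, 'y) cat \<Rightarrow> 'e set \<Rightarrow> ('e \<Rightarrow> 'x) \<Rightarrow> ('e \<Rightarrow> 'y \<Rightarrow> 'e)
      \<Rightarrow> ('e, 'v) cat" where
  "elements j X E pr act =
     \<lparr>Obj = E,
      Arr = j ` {(e, u). e \<in> E \<and> u \<in> Arr X \<and> Cod X u = pr e},
      Dom = (\<lambda>w. act (fst (inv j w)) (snd (inv j w))),
      Cod = (\<lambda>w. fst (inv j w)),
      Id = (\<lambda>e. j (e, Id X (pr e))),
      Comp = (\<lambda>w v. j (fst (inv j w), Comp X (snd (inv j w)) (snd (inv j v))))\<rparr>"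

definition elements_proj ::
    "('e \<times> 'y \<Rightarrow> 'v) \<Rightarrow> ('e \<Rightarrow> 'x) \<Rightarrow> ('e, 'v, 'x, 'y) fctr" where
  "elements_proj j pr = \<lparr>omap = pr, amap = (\<lambda>w. snd (inv j w))\<rparr>"

definition elements_lift ::
    "('e \<times> 'y \<Rightarrow> 'v) \<Rightarrow> ('o, 'a) cat \<Rightarrow> ('o, 'a, 'x, 'y) fctr \<Rightarrow> ('o \<Rightarrow> 'e)
      \<Rightarrow> ('o, 'a, 'e, 'v) fctr" where
  "elements_lift j P \<Phi> h = \<lparr>omap = h, amap = (\<lambda>u. j (h (Cod P u), amap \<Phi> u))\<rparr>"

lemma (in is_functor) amap_arr:
  assumes "u \<in> Arr C"
  shows "amap F u \<in> Arr D" "Dom D (amap F u) = omap F (Dom C u)"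
    "Cod D (amap F u) = omap F (Cod C u)"
  using amap_in[of u "Dom C u" "Cod C u"] assms by (auto simp: hom_def)

context presheaf
begin

lemma hom_elements:
  assumes "inj j"
  shows "w \<in> hom (elements j X E pr act) d e \<longleftrightarrow>
    (\<exists>u. w = j (e, u) \<and> e \<in> E \<and> u \<in> hom X (pr d) (pr e) \<and> d = act e u)"
  using assms pr_act by (auto simp: hom_def elements_def)

lemma category_elements:
  assumes j: "inj j"
  shows "category (elements j X E pr act)" (is "category ?C")
proof
  note H = hom_elements[OF j]
  have inv: "inv j (j a) = a" for a
    using j by simp
  have Id: "Id ?C e = j (e, Id X (pr e))" for e
    by (simp add: elements_def)
  have Comp: "Comp ?C (j (g, v)) (j (e, u)) = j (g, Comp X v u)" for g v e u
    by (simp add: elements_def inv)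
  {
    fix w assume "w \<in> Arr ?C"
    then show "Dom ?C w \<in> Obj ?C" "Cod ?C w \<in> Obj ?C"
      using inv by (auto simp: elements_def hom_def intro!: act_in)
  next
    fix e assume "e \<in> Obj ?C"
    then show "Id ?C e \<in> hom ?C e e"
      unfolding H Id using id_in pr_in act_id by (auto simp: elements_def intro!: exI[of _ "Id X (pr e)"])
  next
    fix w v d e g assume "w \<in> hom ?C d e" "v \<in> hom ?C e g"
    then obtain t u where *: "w = j (e, t)" "t \<in> hom X (pr d) (pr e)" "d = act e t"
        "v = j (g, u)" "g \<in> E" "u \<in> hom X (pr e) (pr g)" "e = act g u"
      unfolding H by blast
    then show "Comp ?C v w \<in> hom ?C d g"
      unfolding H *(1,4) Comp using comp_in[OF *(2,6)] act_comp[OF *(5,6,2)] by metis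
  next
    fix w d e assume "w \<in> hom ?C d e"
    then obtain t where *: "w = j (e, t)" "t \<in> hom X (pr d) (pr e)"
      unfolding H by blast
    show "Comp ?C (Id ?C e) w = w" "Comp ?C w (Id ?C d) = w"
      unfolding Id *(1) Comp using id_left[OF *(2)] id_right[OF *(2)] by simp_all
  next
    fix w v r d e g h assume "w \<in> hom ?C d e" "v \<in> hom ?C e g" "r \<in> hom ?C g h"
    then obtain t u s where *: "w = j (e, t)" "t \<in> hom X (pr d) (pr e)"
        "v = j (g, u)" "u \<in> hom X (pr e) (pr g)" "r = j (h, s)" "s \<in> hom X (pr g) (pr h)"
      unfolding H by blast
    show "Comp ?C r (Comp ?C v w) = Comp ?C (Comp ?C r v) w"
      unfolding *(1,3,5) Comp using assoc[OF *(2,4,6)] by simp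
  }
qed

lemma is_functor_elements_proj:
  assumes j: "inj j"
  shows "is_functor (elements j X E pr act) X (elements_proj j pr)"
proof -
  interpret C: category "elements j X E pr act" by (rule category_elements[OF j])
  have inv: "inv j (j a) = a" for a
    using j by simp
  show ?thesis
  proof
    fix w d e assume "w \<in> hom (elements j X E pr act) d e"
    then show "amap (elements_proj j pr) w
        \<in> hom X (omap (elements_proj j pr) d) (omap (elements_proj j pr) e)"
      by (auto simp: hom_elements[OF j] elements_proj_def inv)
  qed (auto simp: elements_def elements_proj_def inv pr_in)
qed

text \<open>The only lift of \<open>u\<close> at \<open>e\<close> is \<open>j (e, u)\<close>,
  because an arrow encodes exactly its codomain and its image in \<open>X\<close>.\<close>

lemma discrete_fibration_elements:
  assumes j: "inj j"
  shows "discrete_fibration X (elements j X E pr act) (elements_proj j pr)"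
  unfolding discrete_fibration_def
proof (intro conjI ballI impI)
  show "is_functor (elements j X E pr act) X (elements_proj j pr)"
    by (rule is_functor_elements_proj[OF j])
  fix e u
  assume "e \<in> Obj (elements j X E pr act)" "u \<in> Arr X" "Cod X u = omap (elements_proj j pr) e"
  then show "\<exists>!g. g \<in> Arr (elements j X E pr act) \<and> Cod (elements j X E pr act) g = e
      \<and> amap (elements_proj j pr) g = u"
    using j by (intro ex1I[of _ "j (e, u)"]) (auto simp: elements_def elements_proj_def)
qed

text \<open>An arrow \<open>u\<close> must go to the lift of its image in \<open>X\<close> at
  \<open>h (Cod P u)\<close>. The compatibility condition of \<open>family\<close> says that this
  lift starts at \<open>h (Dom P u)\<close>.\<close>

lemma slice_mor_elements_lift:
  assumes j: "inj j" and \<Phi>: "is_functor P X \<Phi>" and h: "family P \<Phi> E pr act h"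
  shows "slice_mor X P \<Phi> (elements j X E pr act) (elements_proj j pr) (elements_lift j P \<Phi> h)"
proof -
  interpret C: is_functor "elements j X E pr act" X "elements_proj j pr"
    by (rule is_functor_elements_proj[OF j])
  interpret \<Phi>: is_functor P X \<Phi> by (rule \<Phi>)
  have hE: "\<And>p. p \<in> Obj P \<Longrightarrow> h p \<in> E \<and> pr (h p) = omap \<Phi> p"
    and hD: "\<And>u. u \<in> Arr P \<Longrightarrow> h (Dom P u) = act (h (Cod P u)) (amap \<Phi> u)"
    using h by (auto simp: family_def)
  have "is_functor P (elements j X E pr act) (elements_lift j P \<Phi> h)"
  proof
    fix p assume p: "p \<in> Obj P"
    show "omap (elements_lift j P \<Phi> h) p \<in> Obj (elements j X E pr act)"
      using hE[OF p] by (simp add: elements_def elements_lift_def)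
    show "amap (elements_lift j P \<Phi> h) (Id P p)
        = Id (elements j X E pr act) (omap (elements_lift j P \<Phi> h) p)"
      using hE[OF p] \<Phi>.amap_id[OF p] \<Phi>.source.id_in[OF p]
      by (simp add: elements_def elements_lift_def hom_def)
  next
    fix u p q assume u: "u \<in> hom P p q"
    then have u': "u \<in> Arr P" "Dom P u = p" "Cod P u = q" "p \<in> Obj P" "q \<in> Obj P"
      using \<Phi>.source.dom_in \<Phi>.source.cod_in by (auto simp: hom_def)
    show "amap (elements_lift j P \<Phi> h) u \<in> hom (elements j X E pr act)
        (omap (elements_lift j P \<Phi> h) p) (omap (elements_lift j P \<Phi> h) q)"
      unfolding hom_elements[OF j] using u' hE[of p] hE[of q] hD[OF u'(1)] \<Phi>.amap_in[OF u]
      by (intro exI[of _ "amap \<Phi> u"]) (auto simp: elements_lift_def)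
  next
    fix u v p q r assume uv: "u \<in> hom P p q" "v \<in> hom P q r"
    show "amap (elements_lift j P \<Phi> h) (Comp P v u) = Comp (elements j X E pr act)
        (amap (elements_lift j P \<Phi> h) v) (amap (elements_lift j P \<Phi> h) u)"
      using j uv \<Phi>.amap_comp[OF uv] \<Phi>.source.comp_in[OF uv]
      by (auto simp: elements_lift_def elements_def hom_def)
  qed
  then show ?thesis
    unfolding slice_mor_def
    using \<Phi> C.is_functor_axioms hE j
    by (auto simp: functor_eq_def fcomp_def elements_lift_def elements_proj_def)
qed

text \<open>The way back from morphisms to families: lying over \<open>\<Phi>\<close> fixes the
  second component of each decoded arrow, and its domain in the category of elements then yields the
  compatibility condition.\<close>

lemma family_slice_mor_elements:
  assumes j: "inj j"
    and G: "slice_mor X P \<Phi> (elements j X E pr act) (elements_proj j pr) G"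
  shows "family P \<Phi> E pr act (omap G)"
  unfolding family_def
proof (intro conjI ballI)
  interpret G: is_functor P "elements j X E pr act" G
    using G by (simp add: slice_mor_def)
  have eq: "functor_eq P (elements_proj j pr \<circ>\<^sub>F G) \<Phi>"
    using G by (simp add: slice_mor_def)
  {
    fix p assume p: "p \<in> Obj P"
    show "omap G p \<in> E" "pr (omap G p) = omap \<Phi> p"
      using G.omap_in[OF p] eq p
      by (auto simp: elements_def functor_eq_def fcomp_def elements_proj_def)
  next
    fix u assume u: "u \<in> Arr P"
    then have "amap \<Phi> u = snd (inv j (amap G u))"
      using eq by (simp add: functor_eq_def fcomp_def elements_proj_def)
    then show "omap G (Dom P u) = act (omap G (Cod P u)) (amap \<Phi> u)"
      using G.amap_arr(2,3)[OF u] by (simp add: elements_def)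
  }
qed

text \<open>Used to cut a presheaf of arbitrary size down to a part that injects into
  \<open>'u\<close>.\<close>

lemma restrict:
  assumes "S \<subseteq> E" and "\<And>e u x. \<lbrakk>e \<in> S; u \<in> hom X x (pr e)\<rbrakk> \<Longrightarrow> act e u \<in> S"
  shows "presheaf X S pr act"
  by standard (use assms pr_in pr_act act_id act_comp in \<open>auto simp: subset_iff\<close>)

text \<open>Renaming the elements along an injection \<open>i\<close>; with values in
  \<open>'u\<close> it moves the presheaf into the universe.\<close>

lemma transport:
  assumes i: "inj_on i E"
  shows "presheaf X (i ` E) (pr \<circ> inv_into E i) (\<lambda>x u. i (act (inv_into E i x) u))"
  by standard (use i pr_in act_in pr_act act_id act_comp in auto)

end

section \<open>Extension of families along the reflection unit\<close>

lemma df_reflection_functor_eq: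
  assumes "df_reflection X P \<Phi> A \<pi> \<eta>"
  shows "p \<in> Obj P \<Longrightarrow> omap \<pi> (omap \<eta> p) = omap \<Phi> p"
    and "u \<in> Arr P \<Longrightarrow> amap \<pi> (amap \<eta> u) = amap \<Phi> u"
    and "is_functor P A \<eta>" and "is_functor A X \<pi>" and "is_functor P X \<Phi>"
  using assms by (auto simp: df_reflection_def slice_mor_def functor_eq_def fcomp_def)

lemma family_compose:
  assumes "is_functor P A \<eta>" and "functor_eq P (\<pi> \<circ>\<^sub>F \<eta>) \<Phi>"
    and "family A \<pi> E pr act k"
  shows "family P \<Phi> E pr act (k \<circ> omap \<eta>)"
proof -
  interpret is_functor P A \<eta> by (rule assms(1))
  show ?thesis
    using assms(2,3) omap_in amap_arr
    by (auto simp: family_def functor_eq_def fcomp_def) metis+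
qed


text \<open>Since the elements and, through \<open>j\<close>, the arrows are of type
  \<open>'u\<close>, the category of elements is among the discrete fibrations tested by
  \<open>df_reflection\<close>. Its universal property is then read through the correspondence of
  families with morphisms over \<open>X\<close>.\<close>

lemma df_reflection_family_in_universe:
  fixes X P A :: "('u, 'u) cat" and E :: "'u set" and j :: "'u \<times> 'u \<Rightarrow> 'u"
  assumes E: "presheaf X E pr act" and j: "inj j" and A: "df_reflection X P \<Phi> A \<pi> \<eta>"
  shows "family P \<Phi> E pr act h
      \<Longrightarrow> \<exists>k. family A \<pi> E pr act k \<and> (\<forall>p\<in>Obj P. k (omap \<eta> p) = h p)" (is "?f \<Longrightarrow> ?ex")
    and "\<lbrakk>family A \<pi> E pr act k; family A \<pi> E pr act k';
        \<forall>p\<in>Obj P. k (omap \<eta> p) = k' (omap \<eta> p)\<rbrakk> \<Longrightarrow> \<forall>a\<in>Obj A. k a = k' a"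
proof -
  interpret E: presheaf X E pr act by (rule E)
  let ?C = "elements j X E pr act" and ?\<rho> = "elements_proj j pr"
  note R = df_reflection_functor_eq[OF A]
  interpret \<eta>: is_functor P A \<eta> by (rule R)
  have univ: "\<exists>G. slice_mor X A \<pi> ?C ?\<rho> G \<and> functor_eq P (G \<circ>\<^sub>F \<eta>) F \<and>
      (\<forall>G'. slice_mor X A \<pi> ?C ?\<rho> G' \<and> functor_eq P (G' \<circ>\<^sub>F \<eta>) F \<longrightarrow> functor_eq A G' G)"
    if "slice_mor X P \<Phi> ?C ?\<rho> F" for F
    using A E.discrete_fibration_elements[OF j] that unfolding df_reflection_def by blast
  {
    assume h: ?f
    obtain G where "slice_mor X A \<pi> ?C ?\<rho> G"
        "functor_eq P (G \<circ>\<^sub>F \<eta>) (elements_lift j P \<Phi> h)"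
      using univ[OF E.slice_mor_elements_lift[OF j R(5) h]] by blast
    then show ?ex
      using E.family_slice_mor_elements[OF j]
      by (intro exI[of _ "omap G"]) (auto simp: functor_eq_def fcomp_def elements_lift_def)
  next
    assume k: "family A \<pi> E pr act k" "family A \<pi> E pr act k'"
      and eq: "\<forall>p\<in>Obj P. k (omap \<eta> p) = k' (omap \<eta> p)"
    have "family P \<Phi> E pr act (k \<circ> omap \<eta>)"
      using family_compose[OF R(3) _ k(1)] R(1,2) by (simp add: functor_eq_def fcomp_def)
    from univ[OF E.slice_mor_elements_lift[OF j R(5) this]] obtain G where
      G: "\<And>G'. \<lbrakk>slice_mor X A \<pi> ?C ?\<rho> G';
        functor_eq P (G' \<circ>\<^sub>F \<eta>) (elements_lift j P \<Phi> (k \<circ> omap \<eta>))\<rbrakk> \<Longrightarrow> functor_eq A G' G"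
      by blast
    \<comment> \<open>Any family agreeing with \<open>k\<close> along the unit induces a second
      factorization, which must equal \<open>G\<close>; this is applied to \<open>k\<close> and to
      \<open>k'\<close>.\<close>
    have "functor_eq A (elements_lift j A \<pi> l) G"
      if "family A \<pi> E pr act l" "\<forall>p\<in>Obj P. k (omap \<eta> p) = l (omap \<eta> p)" for l
    proof (rule G[OF E.slice_mor_elements_lift[OF j R(4) that(1)]])
      show "functor_eq P (elements_lift j A \<pi> l \<circ>\<^sub>F \<eta>) (elements_lift j P \<Phi> (k \<circ> omap \<eta>))"
        using that(2) \<eta>.amap_arr \<eta>.source.cod_in R(2)
        by (simp add: functor_eq_def fcomp_def elements_lift_def)
    qed
    from this[OF k(1)] this[OF k(2) eq] show "\<forall>a\<in>Obj A. k a = k' a"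
      by (simp add: functor_eq_def elements_lift_def)
  }
qed

lemma df_reflection_family_small:
  fixes X P A :: "('u, 'u) cat" and i :: "'e \<Rightarrow> 'u" and j :: "'u \<times> 'u \<Rightarrow> 'u"
  assumes E: "presheaf X E pr act" and i: "inj_on i E" and j: "inj j"
    and A: "df_reflection X P \<Phi> A \<pi> \<eta>"
  shows "family P \<Phi> E pr act h
      \<Longrightarrow> \<exists>k. family A \<pi> E pr act k \<and> (\<forall>p\<in>Obj P. k (omap \<eta> p) = h p)" (is "?f \<Longrightarrow> ?ex")
    and "\<lbrakk>family A \<pi> E pr act k; family A \<pi> E pr act k';
        \<forall>p\<in>Obj P. k (omap \<eta> p) = k' (omap \<eta> p)\<rbrakk> \<Longrightarrow> \<forall>a\<in>Obj A. k a = k' a"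
proof -
  interpret E: presheaf X E pr act by (rule E)
  note R = df_reflection_functor_eq[OF A]
  interpret \<Phi>: is_functor P X \<Phi> by (rule R)
  interpret \<pi>: is_functor A X \<pi> by (rule R)
  interpret \<eta>: is_functor P A \<eta> by (rule R)
  let ?i' = "inv_into E i"
  let ?family = "\<lambda>P \<Phi>. family P \<Phi> (i ` E) (pr \<circ> ?i') (\<lambda>x u. i (act (?i' x) u))"
  note U = df_reflection_family_in_universe[OF E.transport[OF i] j A]
  have to: "?family C \<Gamma> (i \<circ> l)" if "is_functor C X \<Gamma>" "family C \<Gamma> E pr act l"
    for C :: "('u, 'u) cat" and \<Gamma> l
  proof -
    interpret \<Gamma>: is_functor C X \<Gamma> by (rule that)
    show ?thesis
      using that(2) i \<Gamma>.source.cod_in by (auto simp: family_def)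
  qed
  {
    assume ?f
    from U(1)[OF to[OF R(5) this]] obtain k
      where k: "?family A \<pi> k" "\<forall>p\<in>Obj P. k (omap \<eta> p) = i (h p)"
      by auto
    have "family A \<pi> E pr act (?i' \<circ> k)"
      unfolding family_def
    proof (intro conjI ballI)
      fix a assume "a \<in> Obj A"
      then show "(?i' \<circ> k) a \<in> E" "pr ((?i' \<circ> k) a) = omap \<pi> a"
        using k(1) by (auto simp: family_def inv_into_into)
    next
      \<comment> \<open>\<open>inv_into E i\<close> cancels \<open>i\<close> only on
        \<open>E\<close>, so the restricted element must first be shown to lie in
        \<open>E\<close>.\<close>
      fix u assume u: "u \<in> Arr A"
      have "?i' (k (Cod A u)) \<in> E" "pr (?i' (k (Cod A u))) = Cod X (amap \<pi> u)"
        using k(1) \<pi>.source.cod_in[OF u] \<pi>.amap_arr[OF u]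
        by (auto simp: family_def inv_into_into)
      then have "act (?i' (k (Cod A u))) (amap \<pi> u) \<in> E"
        using \<pi>.amap_arr(1)[OF u] by (intro E.act_in) (auto simp: hom_def)
      then show "(?i' \<circ> k) (Dom A u) = act ((?i' \<circ> k) (Cod A u)) (amap \<pi> u)"
        using k(1) u i by (simp add: family_def)
    qed
    moreover have "\<forall>p\<in>Obj P. (?i' \<circ> k) (omap \<eta> p) = h p"
      using k(2) i \<open>?f\<close> by (simp add: family_def)
    ultimately show ?ex by blast
  next
    assume k: "family A \<pi> E pr act k" "family A \<pi> E pr act k'"
      and "\<forall>p\<in>Obj P. k (omap \<eta> p) = k' (omap \<eta> p)"
    then have "\<forall>a\<in>Obj A. (i \<circ> k) a = (i \<circ> k') a"
      by (intro U(2) to R(4)) auto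
    then show "\<forall>a\<in>Obj A. k a = k' a"
      using k inj_onD[OF i] by (auto simp: family_def)
  }
qed

lemma df_reflection_family:
  fixes X P A :: "('u, 'u) cat" and E :: "'e set"
  assumes inf: "infinite (UNIV :: 'u set)" and E: "presheaf X E pr act"
    and A: "df_reflection X P \<Phi> A \<pi> \<eta>"
  shows "family P \<Phi> E pr act h
      \<Longrightarrow> \<exists>k. family A \<pi> E pr act k \<and> (\<forall>p\<in>Obj P. k (omap \<eta> p) = h p)" (is "?f \<Longrightarrow> ?ex")
    and "\<lbrakk>family A \<pi> E pr act k; family A \<pi> E pr act k';
        \<forall>p\<in>Obj P. k (omap \<eta> p) = k' (omap \<eta> p)\<rbrakk> \<Longrightarrow> \<forall>a\<in>Obj A. k a = k' a"
proof -
  interpret E: presheaf X E pr act by (rule E)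
  note R = df_reflection_functor_eq[OF A]
  interpret \<Phi>: is_functor P X \<Phi> by (rule R)
  interpret \<pi>: is_functor A X \<pi> by (rule R)
  interpret \<eta>: is_functor P A \<eta> by (rule R)
  \<comment> \<open>An infinite type is equipotent with its square, which supplies the encoding
    \<open>j\<close> of pairs.\<close>
  have square: "(card_of (UNIV :: ('u \<times> 'u) set), card_of (UNIV :: 'u set)) \<in> ordLeq"
    using card_of_Times_same_infinite[OF inf] ordIso_imp_ordLeq by (simp add: UNIV_Times_UNIV)
  then obtain j :: "'u \<times> 'u \<Rightarrow> 'u" where j: "inj j"
    unfolding card_of_ordLeq[symmetric] by blast
  {
    assume h: ?f
    \<comment> \<open>\<open>S\<close> is the sub-presheaf generated by the family: all restrictions
      of its members \<open>h p\<close>. Its index set \<open>D\<close> consists of pairs over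
      \<open>'u\<close>, so \<open>S\<close> injects into \<open>'u\<close> whatever the size of
      \<open>E\<close>.\<close>
    define D where "D = {(p, u). p \<in> Obj P \<and> u \<in> Arr X \<and> Cod X u = omap \<Phi> p}"
    define S where "S = (\<lambda>(p, u). act (h p) u) ` D"
    have hE: "\<And>p. p \<in> Obj P \<Longrightarrow> h p \<in> E \<and> pr (h p) = omap \<Phi> p"
      using h by (simp add: family_def)
    have "(card_of S, card_of (UNIV :: 'u set)) \<in> ordLeq"
      unfolding S_def
      by (rule ordLeq_transitive[OF ordLeq_transitive[OF card_of_image card_of_mono1] square]) simp
    then obtain i :: "'e \<Rightarrow> 'u" where i: "inj_on i S"
      unfolding card_of_ordLeq[symmetric] by blast
    have SE: "S \<subseteq> E"
      using hE by (auto simp: S_def D_def hom_def intro!: E.act_in)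
    have "presheaf X S pr act"
    proof (rule E.restrict[OF SE])
      fix e u x assume "e \<in> S" and u: "u \<in> hom X x (pr e)"
      then obtain p v where e: "e = act (h p) v" and "p \<in> Obj P"
          "v \<in> Arr X" "Cod X v = omap \<Phi> p"
        by (auto simp: S_def D_def)
      then have p: "p \<in> Obj P" "h p \<in> E" and v: "v \<in> hom X (Dom X v) (pr (h p))"
        using hE[of p] by (simp_all add: hom_def)
      have u': "u \<in> hom X x (Dom X v)"
        using u E.pr_act[OF p(2) v] by (simp add: e)
      \<comment> \<open>Restricting \<open>h p\<close> along \<open>v\<close> and then along
        \<open>u\<close> is restricting it along the composite, so the index is
        \<open>(p, Comp X v u)\<close>.\<close>
      show "act e u \<in> S"
        unfolding S_def e
        using E.comp_in[OF u' v] E.act_comp[OF p(2) v u'] p hE[OF p(1)]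
        by (intro image_eqI[of _ _ "(p, Comp X v u)"]) (auto simp: D_def hom_def)
    qed
    moreover have "family P \<Phi> S pr act h"
      unfolding family_def
    proof (intro conjI ballI)
      fix p assume p: "p \<in> Obj P"
      \<comment> \<open>\<open>h p\<close> is its own restriction along an identity.\<close>
      show "h p \<in> S"
        unfolding S_def
        using p E.act_id[of "h p"] E.id_in[of "pr (h p)"] \<Phi>.omap_in[OF p] hE[OF p]
        by (intro image_eqI[of _ _ "(p, Id X (pr (h p)))"]) (auto simp: D_def hom_def)
    qed (use h in \<open>auto simp: family_def\<close>)
    ultimately obtain k where "family A \<pi> S pr act k" "\<forall>p\<in>Obj P. k (omap \<eta> p) = h p"
      using df_reflection_family_small(1)[OF _ i j A] by blast
    then show ?ex
      using SE by (intro exI[of _ k]) (auto simp: family_def)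
  next
    assume k: "family A \<pi> E pr act k" "family A \<pi> E pr act k'"
      and eq: "\<forall>p\<in>Obj P. k (omap \<eta> p) = k' (omap \<eta> p)"
    \<comment> \<open>Both families take values in \<open>S\<close>, a union of two images of
      \<open>Obj A\<close>, which therefore injects into the infinite type
      \<open>'u\<close>.\<close>
    define S where "S = k ` Obj A \<union> k' ` Obj A"
    have "(card_of (l ` Obj A), card_of (UNIV :: 'u set)) \<in> ordLeq" for l :: "'u \<Rightarrow> 'e"
      by (rule ordLeq_transitive[OF card_of_image card_of_mono1]) simp
    then have "(card_of S, card_of (UNIV :: 'u set)) \<in> ordLeq"
      unfolding S_def using inf
      by (intro card_of_Un_ordLeq_infinite_Field) (simp_all add: Field_card_of card_of_card_order_on)
    then obtain i :: "'e \<Rightarrow> 'u" where i: "inj_on i S"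
      unfolding card_of_ordLeq[symmetric] by blast
    \<comment> \<open>The image of a family on \<open>A\<close> is closed under restriction because
      \<open>A\<close> is a discrete fibration: lifting \<open>u\<close> to an arrow
      \<open>g\<close> into \<open>a\<close> exhibits \<open>act (l a) u\<close> as
      \<open>l (Dom A g)\<close>.\<close>
    have closed: "act (l a) u \<in> l ` Obj A"
      if l: "family A \<pi> E pr act l" and a: "a \<in> Obj A" and u: "u \<in> hom X x (pr (l a))" for l a u x
    proof -
      have "u \<in> Arr X" "Cod X u = omap \<pi> a"
        using l a u by (auto simp: family_def hom_def)
      moreover have "\<forall>a\<in>Obj A. \<forall>f\<in>Arr X. Cod X f = omap \<pi> a \<longrightarrow>
          (\<exists>!g. g \<in> Arr A \<and> Cod A g = a \<and> amap \<pi> g = f)"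
        using A by (simp add: df_reflection_def discrete_fibration_def)
      ultimately obtain g where "g \<in> Arr A" "Cod A g = a" "amap \<pi> g = u"
        using a by blast
      then show ?thesis
        using l \<pi>.source.dom_in by (intro image_eqI[of _ _ "Dom A g"]) (auto simp: family_def)
    qed
    have "S \<subseteq> E"
      using k by (auto simp: S_def family_def)
    then have "presheaf X S pr act"
      by (rule E.restrict) (use closed[OF k(1)] closed[OF k(2)] in \<open>auto simp: S_def\<close>)
    then show "\<forall>a\<in>Obj A. k a = k' a"
      by (rule df_reflection_family_small(2)[OF _ i j A _ _ eq])
        (use k in \<open>auto simp: S_def family_def\<close>)
  }
qed

section \<open>Cocones as families\<close>

text \<open>The presheaf of the discrete fibration \<open>f/c\<close>.\<close>

definition slice_elements ::
    "('x, 'y) cat \<Rightarrow> ('p, 'b) cat \<Rightarrow> ('x, 'y, 'p, 'b) fctr \<Rightarrow> 'p \<Rightarrow> ('x \<times> 'b) set" where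
  "slice_elements X Y f c = {(x, g). x \<in> Obj X \<and> g \<in> hom Y (omap f x) c}"

text \<open>The first component is tracked because \<open>f\<close> may identify objects of
  \<open>X\<close>, so that \<open>snd e\<close> alone does not determine where \<open>e\<close>
  lies.\<close>

definition slice_act ::
    "('x, 'y) cat \<Rightarrow> ('p, 'b) cat \<Rightarrow> ('x, 'y, 'p, 'b) fctr \<Rightarrow> 'x \<times> 'b \<Rightarrow> 'y \<Rightarrow> 'x \<times> 'b" where
  "slice_act X Y f e u = (Dom X u, Comp Y (snd e) (amap f u))"

lemma presheaf_slice:
  assumes "is_functor X Y f"
  shows "presheaf X (slice_elements X Y f c) fst (slice_act X Y f)"
proof -
  interpret f: is_functor X Y f by (rule assms)
  show ?thesis
  proof
    fix e u x assume "e \<in> slice_elements X Y f c" "u \<in> hom X x (fst e)"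
    then show "slice_act X Y f e u \<in> slice_elements X Y f c" "fst (slice_act X Y f e u) = x"
      using f.source.dom_in f.target.comp_in[OF f.amap_in]
      by (auto simp: slice_elements_def slice_act_def hom_def)
  next
    fix e assume "e \<in> slice_elements X Y f c"
    then show "slice_act X Y f e (Id X (fst e)) = e"
      using f.amap_id[of "fst e"] f.target.id_right[of "snd e" "omap f (fst e)" c]
        f.source.id_in[of "fst e"]
      by (auto simp: slice_elements_def slice_act_def hom_def)
  next
    fix e u v x y
    assume e: "e \<in> slice_elements X Y f c" and u: "u \<in> hom X y (fst e)" and v: "v \<in> hom X x y"
    then show "slice_act X Y f e (Comp X u v) = slice_act X Y f (slice_act X Y f e u) v"
      using f.amap_comp[OF v u] f.source.comp_in[OF v u] f.target.assoc[OF f.amap_in[OF v] f.amap_in[OF u]]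
      by (auto simp: slice_elements_def slice_act_def hom_def)
  qed (auto simp: slice_elements_def)
qed

text \<open>Only the second components carry information once the first ones are fixed, and
  compatibility with precomposition is the cocone equation. That \<open>c\<close> is an object is
  required separately, as a family on an empty \<open>P\<close> says nothing about
  \<open>c\<close>.\<close>

lemma family_slice_iff:
  assumes "is_functor P X \<Phi>" and "c \<in> Obj Y" and h: "\<And>p. p \<in> Obj P \<Longrightarrow> fst (h p) = omap \<Phi> p"
  shows "family P \<Phi> (slice_elements X Y f c) fst (slice_act X Y f) h
    \<longleftrightarrow> cocone P Y (f \<circ>\<^sub>F \<Phi>) c (snd \<circ> h)"
proof -
  interpret \<Phi>: is_functor P X \<Phi> by (rule assms)
  have "h p \<in> slice_elements X Y f c \<longleftrightarrow> snd (h p) \<in> hom Y (omap f (omap \<Phi> p)) c"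
    if "p \<in> Obj P" for p
    using h[OF that] \<Phi>.omap_in[OF that] by (cases "h p") (simp add: slice_elements_def)
  moreover have "h (Dom P u) = slice_act X Y f (h (Cod P u)) (amap \<Phi> u)
      \<longleftrightarrow> Comp Y (snd (h (Cod P u))) (amap f (amap \<Phi> u)) = snd (h (Dom P u))"
    if "u \<in> Arr P" for u
    using h[OF \<Phi>.source.dom_in[OF that]] \<Phi>.amap_arr(2)[OF that]
    by (cases "h (Dom P u)") (auto simp: slice_act_def)
  ultimately show ?thesis
    using h \<open>c \<in> Obj Y\<close> by (simp add: family_def cocone_def fcomp_def)
qed

section \<open>Comparison of cocones\<close>

text \<open>Restriction along \<open>r\<close> is a bijection from cocones on \<open>H\<close> to
  cocones on \<open>F\<close>, for every vertex: the clauses after the first are well-definedness,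
  surjectivity and injectivity. Cocones are compared on objects of the source only, as their values
  elsewhere are arbitrary.\<close>

definition same_cocones ::
    "('p, 'b) cat \<Rightarrow> ('o, 'a) cat \<Rightarrow> ('o, 'a, 'p, 'b) fctr
      \<Rightarrow> ('q, 'c) cat \<Rightarrow> ('q, 'c, 'p, 'b) fctr \<Rightarrow> ('o \<Rightarrow> 'q) \<Rightarrow> bool" where
  "same_cocones Y P F A H r \<longleftrightarrow>
     r ` Obj P \<subseteq> Obj A \<and>
     (\<forall>c \<kappa>. cocone A Y H c \<kappa> \<longrightarrow> cocone P Y F c (\<kappa> \<circ> r)) \<and>
     (\<forall>c \<kappa>. cocone P Y F c \<kappa> \<longrightarrow> (\<exists>\<mu>. cocone A Y H c \<mu> \<and> (\<forall>p\<in>Obj P. \<mu> (r p) = \<kappa> p))) \<and>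
     (\<forall>c \<kappa> \<mu>. cocone A Y H c \<kappa> \<and> cocone A Y H c \<mu> \<and> (\<forall>p\<in>Obj P. \<kappa> (r p) = \<mu> (r p))
        \<longrightarrow> (\<forall>a\<in>Obj A. \<kappa> a = \<mu> a))"

lemma cocone_slice_mor:
  assumes K: "slice_mor X C \<gamma> D \<delta> K" and \<kappa>: "cocone D Y (f \<circ>\<^sub>F \<delta>) c \<kappa>"
  shows "cocone C Y (f \<circ>\<^sub>F \<gamma>) c (\<kappa> \<circ> omap K)"
proof -
  interpret K: is_functor C D K using K by (simp add: slice_mor_def)
  have eq: "\<And>x. x \<in> Obj C \<Longrightarrow> omap \<delta> (omap K x) = omap \<gamma> x"
    "\<And>u. u \<in> Arr C \<Longrightarrow> amap \<delta> (amap K u) = amap \<gamma> u"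
    using K by (auto simp: slice_mor_def functor_eq_def fcomp_def)
  show ?thesis
    unfolding cocone_def
  proof (intro conjI ballI)
    show "c \<in> Obj Y" using \<kappa> by (simp add: cocone_def)
  next
    fix x assume x: "x \<in> Obj C"
    then have "\<kappa> (omap K x) \<in> hom Y (omap f (omap \<delta> (omap K x))) c"
      using \<kappa> K.omap_in by (simp add: cocone_def fcomp_def)
    then show "(\<kappa> \<circ> omap K) x \<in> hom Y (omap (f \<circ>\<^sub>F \<gamma>) x) c"
      by (simp add: fcomp_def eq(1)[OF x])
  next
    fix u assume u: "u \<in> Arr C"
    then have "Comp Y (\<kappa> (Cod D (amap K u))) (amap f (amap \<delta> (amap K u))) = \<kappa> (Dom D (amap K u))"
      using \<kappa> K.amap_arr(1) by (simp add: cocone_def fcomp_def)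
    then show "Comp Y ((\<kappa> \<circ> omap K) (Cod C u)) (amap (f \<circ>\<^sub>F \<gamma>) u) = (\<kappa> \<circ> omap K) (Dom C u)"
      by (simp add: fcomp_def K.amap_arr(2,3)[OF u] eq(2)[OF u])
  qed
qed

text \<open>Pairing each component of a cocone with the object of \<open>X\<close> below it gives a
  family in the presheaf of \<open>f/c\<close>. Surjectivity and injectivity of restriction are then
  the two parts of \<open>df_reflection_family\<close>.\<close>

lemma same_cocones_df_reflection:
  fixes X P A :: "('u, 'u) cat" and f :: "('u, 'u, 'yo, 'ya) fctr"
  assumes inf: "infinite (UNIV :: 'u set)" and A: "df_reflection X P \<Phi> A \<pi> \<eta>"
    and f: "is_functor X Y f"
  shows "same_cocones Y P (f \<circ>\<^sub>F \<Phi>) A (f \<circ>\<^sub>F \<pi>) (omap \<eta>)"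
  unfolding same_cocones_def
proof (intro conjI allI impI)
  note R = df_reflection_functor_eq[OF A]
  interpret \<eta>: is_functor P A \<eta> by (rule R)
  have \<eta>: "slice_mor X P \<Phi> A \<pi> \<eta>"
    using A by (simp add: df_reflection_def)
  let ?family = "\<lambda>P \<Phi> c. family P \<Phi> (slice_elements X Y f c) fst (slice_act X Y f)"
  note U = df_reflection_family[OF inf presheaf_slice[OF f] A]
  have family: "?family C \<Gamma> c (\<lambda>x. (omap \<Gamma> x, \<kappa> x)) \<longleftrightarrow> cocone C Y (f \<circ>\<^sub>F \<Gamma>) c \<kappa>"
    if "is_functor C X \<Gamma>" "c \<in> Obj Y" for C :: "('u, 'u) cat" and \<Gamma> c \<kappa>
    using family_slice_iff[OF that, of "\<lambda>x. (omap \<Gamma> x, \<kappa> x)" f] by (simp add: comp_def)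
  show "omap \<eta> ` Obj P \<subseteq> Obj A"
    using \<eta>.omap_in by blast
  fix c \<kappa>
  {
    assume "cocone A Y (f \<circ>\<^sub>F \<pi>) c \<kappa>"
    then show "cocone P Y (f \<circ>\<^sub>F \<Phi>) c (\<kappa> \<circ> omap \<eta>)"
      by (rule cocone_slice_mor[OF \<eta>])
  next
    assume \<kappa>: "cocone P Y (f \<circ>\<^sub>F \<Phi>) c \<kappa>"
    then have c: "c \<in> Obj Y" by (simp add: cocone_def)
    then have "?family P \<Phi> c (\<lambda>p. (omap \<Phi> p, \<kappa> p))"
      using family[OF R(5)] \<kappa> by simp
    from U(1)[OF this] obtain k where k: "?family A \<pi> c k"
        "\<forall>p\<in>Obj P. k (omap \<eta> p) = (omap \<Phi> p, \<kappa> p)"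
      by blast
    then have "cocone A Y (f \<circ>\<^sub>F \<pi>) c (snd \<circ> k)"
      using family_slice_iff[OF R(4) c, of k f] by (auto simp: family_def)
    then show "\<exists>\<mu>. cocone A Y (f \<circ>\<^sub>F \<pi>) c \<mu> \<and> (\<forall>p\<in>Obj P. \<mu> (omap \<eta> p) = \<kappa> p)"
      using k(2) by (intro exI[of _ "snd \<circ> k"]) simp
  next
    fix \<mu>
    assume *: "cocone A Y (f \<circ>\<^sub>F \<pi>) c \<kappa> \<and> cocone A Y (f \<circ>\<^sub>F \<pi>) c \<mu> \<and>
      (\<forall>p\<in>Obj P. \<kappa> (omap \<eta> p) = \<mu> (omap \<eta> p))"
    then have "c \<in> Obj Y" by (simp add: cocone_def)
    then have "\<forall>a\<in>Obj A. (omap \<pi> a, \<kappa> a) = (omap \<pi> a, \<mu> a)"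
      using * family[OF R(4)] by (intro U(2)) auto
    then show "\<forall>a\<in>Obj A. \<kappa> a = \<mu> a" by simp
  }
qed

lemma same_cocones_slice_iso:
  assumes "slice_iso X A \<pi> B \<rho>"
  obtains r where "same_cocones Y A (f \<circ>\<^sub>F \<pi>) B (f \<circ>\<^sub>F \<rho>) r"
proof -
  obtain F G where F: "slice_mor X A \<pi> B \<rho> F" and G: "slice_mor X B \<rho> A \<pi> G"
    and GF: "functor_eq A (G \<circ>\<^sub>F F) fid" and FG: "functor_eq B (F \<circ>\<^sub>F G) fid"
    using assms by (auto simp: slice_iso_def)
  interpret F: is_functor A B F using F by (simp add: slice_mor_def)
  interpret G: is_functor B A G using G by (simp add: slice_mor_def)
  have GF': "\<And>a. a \<in> Obj A \<Longrightarrow> omap G (omap F a) = a"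
    and FG': "\<And>b. b \<in> Obj B \<Longrightarrow> omap F (omap G b) = b"
    using GF FG by (auto simp: functor_eq_def fcomp_def fid_def)
  have "same_cocones Y A (f \<circ>\<^sub>F \<pi>) B (f \<circ>\<^sub>F \<rho>) (omap F)"
    unfolding same_cocones_def
  proof (intro conjI allI impI)
    show "omap F ` Obj A \<subseteq> Obj B" using F.omap_in by blast
    fix c \<kappa>
    {
      assume "cocone B Y (f \<circ>\<^sub>F \<rho>) c \<kappa>"
      then show "cocone A Y (f \<circ>\<^sub>F \<pi>) c (\<kappa> \<circ> omap F)" by (rule cocone_slice_mor[OF F])
    next
      assume "cocone A Y (f \<circ>\<^sub>F \<pi>) c \<kappa>"
      then show "\<exists>\<mu>. cocone B Y (f \<circ>\<^sub>F \<rho>) c \<mu> \<and> (\<forall>p\<in>Obj A. \<mu> (omap F p) = \<kappa> p)"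
        \<comment> \<open>A cocone is extended along \<open>F\<close> by restricting it along the
          inverse \<open>G\<close>.\<close>
        using cocone_slice_mor[OF G] GF' by (intro exI[of _ "\<kappa> \<circ> omap G"]) simp
    next
      fix \<mu>
      assume "cocone B Y (f \<circ>\<^sub>F \<rho>) c \<kappa> \<and> cocone B Y (f \<circ>\<^sub>F \<rho>) c \<mu> \<and>
        (\<forall>p\<in>Obj A. \<kappa> (omap F p) = \<mu> (omap F p))"
      then show "\<forall>b\<in>Obj B. \<kappa> b = \<mu> b" using FG' G.omap_in by metis
    }
  qed
  then show thesis by (rule that)
qed

section \<open>Transfer and uniqueness of colimits\<close>

lemma is_functor_fcomp:
  assumes "is_functor C D F" and "is_functor D E G"
  shows "is_functor C E (G \<circ>\<^sub>F F)"
proof -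
  interpret F: is_functor C D F by (rule assms)
  interpret G: is_functor D E G by (rule assms)
  show ?thesis
    by standard (auto simp: fcomp_def F.omap_in G.omap_in F.amap_in G.amap_in F.amap_id G.amap_id
        F.amap_comp G.amap_comp[OF F.amap_in F.amap_in])
qed

lemma cocone_compose:
  assumes "is_functor P Y F" and \<kappa>: "cocone P Y F c \<kappa>" and h: "h \<in> hom Y c d"
  shows "cocone P Y F d (\<lambda>p. Comp Y h (\<kappa> p))"
proof -
  interpret F: is_functor P Y F by (rule assms)
  have "Comp Y (Comp Y h (\<kappa> (Cod P u))) (amap F u) = Comp Y h (\<kappa> (Dom P u))"
    if u: "u \<in> Arr P" for u
  proof -
    have "amap F u \<in> hom Y (omap F (Dom P u)) (omap F (Cod P u))"
      using u by (intro F.amap_in) (simp add: hom_def)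
    moreover have "\<kappa> (Cod P u) \<in> hom Y (omap F (Cod P u)) c"
      using \<kappa> F.source.cod_in[OF u] by (simp add: cocone_def)
    ultimately have "Comp Y (Comp Y h (\<kappa> (Cod P u))) (amap F u)
        = Comp Y h (Comp Y (\<kappa> (Cod P u)) (amap F u))"
      using F.target.assoc[OF _ _ h] by simp
    then show ?thesis
      using \<kappa> u by (simp add: cocone_def)
  qed
  then show ?thesis
    using \<kappa> h F.target.comp_in F.target.cod_in by (auto simp: cocone_def hom_def)
qed

text \<open>Instantiated with \<open>Ex\<close> and \<open>Ex1\<close> for \<open>Q\<close>, this covers weak colimits and colimits.\<close>

lemma same_cocones_universal:
  assumes H: "is_functor A Y H" and same: "same_cocones Y P F A H r"
  shows "(\<exists>\<kappa>. cocone P Y F c \<kappa> \<and> (\<forall>d \<mu>. cocone P Y F d \<mu> \<longrightarrow>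
        Q (\<lambda>h. h \<in> hom Y c d \<and> (\<forall>p\<in>Obj P. Comp Y h (\<kappa> p) = \<mu> p))))
    \<longleftrightarrow> (\<exists>\<kappa>. cocone A Y H c \<kappa> \<and> (\<forall>d \<mu>. cocone A Y H d \<mu> \<longrightarrow>
        Q (\<lambda>h. h \<in> hom Y c d \<and> (\<forall>a\<in>Obj A. Comp Y h (\<kappa> a) = \<mu> a))))"
    (is "(\<exists>\<kappa>. ?P \<kappa>) \<longleftrightarrow> (\<exists>\<kappa>. ?A \<kappa>)")
proof
  have r: "\<And>p. p \<in> Obj P \<Longrightarrow> r p \<in> Obj A"
    and pull: "\<And>c \<kappa>. cocone A Y H c \<kappa> \<Longrightarrow> cocone P Y F c (\<kappa> \<circ> r)"
    and extend: "\<And>c \<kappa>. cocone P Y F c \<kappa> \<Longrightarrow> \<exists>\<mu>. cocone A Y H c \<mu> \<and> (\<forall>p\<in>Obj P. \<mu> (r p) = \<kappa> p)"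
    and unique: "\<And>c \<kappa> \<mu>. \<lbrakk>cocone A Y H c \<kappa>; cocone A Y H c \<mu>; \<forall>p\<in>Obj P. \<kappa> (r p) = \<mu> (r p)\<rbrakk>
        \<Longrightarrow> \<forall>a\<in>Obj A. \<kappa> a = \<mu> a"
    using same by (auto simp: same_cocones_def)
  \<comment> \<open>Composing \<open>\<kappa>\<close> with \<open>h\<close> gives a cocone on
    \<open>H\<close>, and two such cocones agree as soon as they agree along \<open>r\<close>. Hence
    the predicates defining mediating arrows are equal, and any quantifier \<open>Q\<close> may be
    applied to them.\<close>
  have key: "(\<lambda>h. h \<in> hom Y c d \<and> (\<forall>a\<in>Obj A. Comp Y h (\<kappa> a) = \<mu> a))
      = (\<lambda>h. h \<in> hom Y c d \<and> (\<forall>p\<in>Obj P. Comp Y h (\<kappa> (r p)) = \<mu> (r p)))"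
    if "cocone A Y H c \<kappa>" "cocone A Y H d \<mu>" for d \<kappa> \<mu>
  proof -
    have "(\<forall>a\<in>Obj A. Comp Y h (\<kappa> a) = \<mu> a) \<longleftrightarrow> (\<forall>p\<in>Obj P. Comp Y h (\<kappa> (r p)) = \<mu> (r p))"
      if h: "h \<in> hom Y c d" for h
      using unique[OF cocone_compose[OF H \<open>cocone A Y H c \<kappa>\<close> h] \<open>cocone A Y H d \<mu>\<close>]
      by (metis r)
    then show ?thesis by (intro HOL.ext conj_cong refl)
  qed
  {
    assume "\<exists>\<kappa>. ?P \<kappa>"
    then obtain \<kappa> where \<kappa>: "?P \<kappa>" by blast
    then obtain \<nu> where l: "cocone A Y H c \<nu>" "\<forall>p\<in>Obj P. \<nu> (r p) = \<kappa> p"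
      using extend by blast
    have "Q (\<lambda>h. h \<in> hom Y c d \<and> (\<forall>a\<in>Obj A. Comp Y h (\<nu> a) = \<mu> a))"
      if \<mu>: "cocone A Y H d \<mu>" for d \<mu>
    proof -
      \<comment> \<open>The universal property of \<open>\<kappa>\<close> is tested on the
        restriction of \<open>\<mu>\<close> along \<open>r\<close>.\<close>
      have "Q (\<lambda>h. h \<in> hom Y c d \<and> (\<forall>p\<in>Obj P. Comp Y h (\<kappa> p) = (\<mu> \<circ> r) p))"
        using \<kappa> pull[OF \<mu>] by blast
      then show ?thesis
        using l(2) by (simp add: key[OF l(1) \<mu>])
    qed
    then show "\<exists>\<kappa>. ?A \<kappa>" using l(1) by blast
  next
    assume "\<exists>\<kappa>. ?A \<kappa>"
    then obtain \<kappa> where \<kappa>: "?A \<kappa>" by blast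
    have "Q (\<lambda>h. h \<in> hom Y c d \<and> (\<forall>p\<in>Obj P. Comp Y h ((\<kappa> \<circ> r) p) = \<mu> p))"
      if \<mu>: "cocone P Y F d \<mu>" for d \<mu>
    proof -
      \<comment> \<open>Conversely, a cocone on \<open>F\<close> is first extended to one on
        \<open>H\<close>, where the universal property is available.\<close>
      obtain \<mu>' where m: "cocone A Y H d \<mu>'" "\<forall>p\<in>Obj P. \<mu>' (r p) = \<mu> p"
        using extend[OF \<mu>] by auto
      have "Q (\<lambda>h. h \<in> hom Y c d \<and> (\<forall>a\<in>Obj A. Comp Y h (\<kappa> a) = \<mu>' a))"
        using \<kappa> m(1) by blast
      then show ?thesis
        using \<kappa> m(2) by (simp add: key[OF _ m(1)])
    qed
    then show "\<exists>\<kappa>. ?P \<kappa>" using \<kappa> pull by blast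
  }
qed

lemma same_cocones_colimit:
  assumes "is_functor A Y H" and "same_cocones Y P F A H r"
  shows "is_colimit P Y F c \<longleftrightarrow> is_colimit A Y H c"
    and "is_weak_colimit P Y F c \<longleftrightarrow> is_weak_colimit A Y H c"
  unfolding is_colimit_def is_weak_colimit_def
  using same_cocones_universal[OF assms, where Q = Ex1]
    same_cocones_universal[OF assms, where Q = Ex] by simp_all

lemma ex1_unique: "\<lbrakk>\<exists>!x. P x; P x; P y\<rbrakk> \<Longrightarrow> x = y"
  by blast

lemma is_colimit_unique:
  assumes F: "is_functor P Y F" and c: "is_colimit P Y F c" and d: "is_colimit P Y F d"
  shows "iso_obj Y c d"
proof -
  interpret F: is_functor P Y F by (rule F)
  obtain \<kappa> where \<kappa>: "cocone P Y F c \<kappa>"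
    and uc: "\<And>d \<mu>. cocone P Y F d \<mu> \<Longrightarrow> \<exists>!h. h \<in> hom Y c d \<and> (\<forall>p\<in>Obj P. Comp Y h (\<kappa> p) = \<mu> p)"
    using c by (auto simp: is_colimit_def)
  obtain \<mu> where \<mu>: "cocone P Y F d \<mu>"
    and ud: "\<And>c \<kappa>. cocone P Y F c \<kappa> \<Longrightarrow> \<exists>!h. h \<in> hom Y d c \<and> (\<forall>p\<in>Obj P. Comp Y h (\<mu> p) = \<kappa> p)"
    using d by (auto simp: is_colimit_def)
  obtain h where h: "h \<in> hom Y c d" "\<And>p. p \<in> Obj P \<Longrightarrow> Comp Y h (\<kappa> p) = \<mu> p"
    using uc[OF \<mu>] by blast
  obtain k where k: "k \<in> hom Y d c" "\<And>p. p \<in> Obj P \<Longrightarrow> Comp Y k (\<mu> p) = \<kappa> p"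
    using ud[OF \<kappa>] by blast
  have cd: "c \<in> Obj Y" "d \<in> Obj Y"
    using \<kappa> \<mu> by (auto simp: cocone_def)
  have \<kappa>p: "\<kappa> p \<in> hom Y (omap F p) c" and \<mu>p: "\<mu> p \<in> hom Y (omap F p) d" if "p \<in> Obj P" for p
    using that \<kappa> \<mu> by (auto simp: cocone_def)
  \<comment> \<open>The round trips and the identities all mediate from a colimit cocone to itself,
    so uniqueness makes them equal.\<close>
  have "Comp Y (Comp Y k h) (\<kappa> p) = \<kappa> p" "Comp Y (Id Y c) (\<kappa> p) = \<kappa> p"
    "Comp Y (Comp Y h k) (\<mu> p) = \<mu> p" "Comp Y (Id Y d) (\<mu> p) = \<mu> p" if "p \<in> Obj P" for p
    using h(2)[OF that] k(2)[OF that] F.target.assoc[OF \<kappa>p[OF that] h(1) k(1)]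
      F.target.assoc[OF \<mu>p[OF that] k(1) h(1)]
      F.target.id_left[OF \<kappa>p[OF that]] F.target.id_left[OF \<mu>p[OF that]] by simp_all
  moreover have "Comp Y k h \<in> hom Y c c" "Comp Y h k \<in> hom Y d d"
    using F.target.comp_in[OF h(1) k(1)] F.target.comp_in[OF k(1) h(1)] by simp_all
  ultimately have "Comp Y k h = Id Y c" "Comp Y h k = Id Y d"
    by (auto intro: ex1_unique[OF uc[OF \<kappa>]] ex1_unique[OF ud[OF \<mu>]]
        F.target.id_in[OF cd(1)] F.target.id_in[OF cd(2)])
  then show ?thesis
    using h(1) k(1) cd unfolding iso_obj_def by blast
qed

theorem proposition27:
  fixes X P Q A B :: "('u, 'u) cat"
    and \<Phi> \<Psi> \<pi> \<rho> \<eta> \<theta> :: "('u, 'u, 'u, 'u) fctr"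
    and Y :: "('yo, 'ya) cat"
    and f :: "('u, 'u, 'yo, 'ya) fctr"
  assumes "infinite (UNIV :: 'u set)"
    and "is_functor P X \<Phi>"
    and "is_functor Q X \<Psi>"
    and "df_reflection X P \<Phi> A \<pi> \<eta>"
    and "df_reflection X Q \<Psi> B \<rho> \<theta>"
    and "slice_iso X A \<pi> B \<rho>"
    and "is_functor X Y f"
  shows "((\<exists>c. is_colimit P Y (f \<circ>\<^sub>F \<Phi>) c) \<longleftrightarrow> (\<exists>d. is_colimit Q Y (f \<circ>\<^sub>F \<Psi>) d))
    \<and> (\<forall>c d. is_colimit P Y (f \<circ>\<^sub>F \<Phi>) c \<and> is_colimit Q Y (f \<circ>\<^sub>F \<Psi>) d \<longrightarrow> iso_obj Y c d)
    \<and> (\<forall>c. is_weak_colimit P Y (f \<circ>\<^sub>F \<Phi>) c \<longleftrightarrow> is_weak_colimit Q Y (f \<circ>\<^sub>F \<Psi>) c)"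
proof -
  note inf = assms(1) and R = df_reflection_functor_eq[OF assms(4)]
    and S = df_reflection_functor_eq[OF assms(5)] and f = assms(7)
  obtain r where r: "same_cocones Y A (f \<circ>\<^sub>F \<pi>) B (f \<circ>\<^sub>F \<rho>) r"
    by (rule same_cocones_slice_iso[OF assms(6)])
  \<comment> \<open>The three comparisons lead from \<open>P\<close> to \<open>A\<close>, from
    \<open>Q\<close> to \<open>B\<close> and from \<open>A\<close> to \<open>B\<close>. After
    rewriting, every claim concerns the single diagram \<open>f \<circ> \<rho>\<close> on
    \<open>B\<close>, and what remains is uniqueness of its colimit up to isomorphism.\<close>
  note PA = same_cocones_colimit[OF is_functor_fcomp[OF R(4) f]
      same_cocones_df_reflection[OF inf assms(4) f]]
    and QB = same_cocones_colimit[OF is_functor_fcomp[OF S(4) f]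
      same_cocones_df_reflection[OF inf assms(5) f]]
    and AB = same_cocones_colimit[OF is_functor_fcomp[OF S(4) f] r]
  show ?thesis
    unfolding PA QB AB using is_colimit_unique[OF is_functor_fcomp[OF S(4) f]] by blast
qed

end
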